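(* Let $m$ be an even (nonnegative) integer and $l$ a positive integer. For an $m \times m$ skew-symmetric matrix $A$, an $l \times l$ skew-symmetric matrix $B$, and an $m \times l$ matrix $S$, we have $$ \sum_K \operatorname{Pf} B(K)\, \operatorname{Pf} \begin{pmatrix} A & S([m];K) \\ - {}^t S([m];K) & O \end{pmatrix} = \operatorname{Pf} \left( A - S B\, {}^t S \right), $$ where $K$ runs over all even-element subsets of $[l]$ (including the empty set).
   Context: All matrices have entries in a fixed commutative ring; skew-symmetric means ${}^tX=-X$ with zero diagonal, where ${}^tX$ is the transpose. For a skew-symmetric matrix $X=(x_{ij})_{1\le i,j\le 2r}$ of even order, the Pfaffian is $$\operatorname{Pf}(X)=\sum_{\sigma\in F_{2r}}\operatorname{sgn}(\sigma)\prod_{i=1}^r x_{\sigma(2i-1),\sigma(2i)},$$ where $F_{2r}$ is the set of permutations $\sigma\in S_{2r}$ with $\sigma(1)<\sigma(3)<\dots<\sigma(2r-1)$ and $\sigma(2i-1)<\sigma(2i)$ for $1\le i\le r$. The Pfaffian of the empty ($0\times 0$) matrix is $1$. We write $[n]=\{1,2,\dots,n\}$. For an $M\times N$ matrix $X$ and subsets $I\subset[M]$, $J\subset[N]$, $X(I;J)$ denotes the submatrix of $X$ with rows indexed by $I$ and columns indexed by $J$ (in increasing order); for a skew-symmetric $X$ we write $X(I)=X(I;I)$. $O$ denotes a zero matrix of the appropriate size. *)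

theory Defs
  imports
    "Jordan_Normal_Form.Determinant"
    "Jordan_Normal_Form.DL_Submatrix"
begin

text \<open>Matrices are indexed from 0, so the index set \<open>[n] = {1, \<dots>, n}\<close> becomes \<open>{0..<n}\<close>.\<close>

text \<open>The condition on the diagonal does not follow from the first one in characteristic 2.\<close>

definition skew_symmetric_mat :: "'a :: comm_ring_1 mat \<Rightarrow> bool" where
  "skew_symmetric_mat X \<longleftrightarrow>
     square_mat X \<and> transpose_mat X = - X \<and> (\<forall>i<dim_row X. X $$ (i, i) = 0)"

text \<open>After the index shift, the 1-based positions \<open>2i - 1\<close> and \<open>2i\<close>
  (\<open>1 \<le> i \<le> r\<close>) are \<open>2i\<close> and \<open>2i + 1\<close> (\<open>0 \<le> i < r\<close>).
  The shift is an order-preserving relabelling, so signs are unchanged.\<close>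

definition pfaffian_perms :: "nat \<Rightarrow> (nat \<Rightarrow> nat) set" where
  "pfaffian_perms r =
     {\<sigma>. \<sigma> permutes {0..<2 * r} \<and>
         (\<forall>i j. i < j \<longrightarrow> j < r \<longrightarrow> \<sigma> (2 * i) < \<sigma> (2 * j)) \<and>
         (\<forall>i<r. \<sigma> (2 * i) < \<sigma> (2 * i + 1))}"

text \<open>Meaningful only for skew-symmetric matrices of even order.\<close>

definition pfaffian :: "'a :: comm_ring_1 mat \<Rightarrow> 'a" where
  "pfaffian X =
     (let r = dim_row X div 2 in
      \<Sum>\<sigma>\<in>pfaffian_perms r. of_int (sign \<sigma>) * (\<Prod>i<r. X $$ (\<sigma> (2 * i), \<sigma> (2 * i + 1))))"

end

theory Submission
  imports Defs
begin

text \<open>Write \<open>X\<^sub>K\<close> for the bordered matrix of \<open>A\<close> and the columns \<open>K\<close> of \<open>S\<close>, and let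
  \<open>G(x\<^sub>1 \<dots> x\<^sub>n) = \<Sum>\<^sub>K Pf B(K) Pf X\<^sub>K(x\<^sub>1 \<dots> x\<^sub>n K)\<close>, where the Pfaffian of a list of indices is
  defined by expansion along its first entry. Expand \<open>Pf X\<^sub>K\<close> along \<open>x\<^sub>1\<close>. The entries of \<open>A\<close> give
  one part of the wanted recursion. An entry \<open>S(x\<^sub>1, j)\<close> removes \<open>j\<close> from \<open>K\<close>; summing over
  \<open>K - {j}\<close> instead of \<open>K\<close> (where \<open>j \<in> K - {j}\<close> may be admitted, since a repeated index gives 0),
  expanding \<open>Pf B\<close> along \<open>j\<close>, shifting the summation by the next index \<open>i\<close> in the same way, and
  expanding \<open>Pf X\<^sub>K\<close> along \<open>i\<close> yields the entry of \<open>- S B S\<^sup>T\<close> at \<open>(x\<^sub>1, x\<^sub>k)\<close>. So \<open>G\<close> and the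
  Pfaffian of \<open>A - S B S\<^sup>T\<close> satisfy the same recursion. Only alternation is used, never division,
  so the characteristic plays no role.\<close>

section \<open>Signed expansion of a function of lists along a linear form\<close>

text \<open>This is the contraction (interior product) of \<open>\<Phi>\<close> with
  \<open>g\<close>: each entry is deleted in turn, with alternating sign. \<open>\<Phi>\<close> is a
  parameter so that contractions compose and the Pfaffian can recurse through it.\<close>

primrec expand :: "('b \<Rightarrow> 'a) \<Rightarrow> ('b list \<Rightarrow> 'a) \<Rightarrow> 'b list \<Rightarrow> 'a :: comm_ring_1" where
  "expand g \<Phi> [] = 0"
| "expand g \<Phi> (v # vs) = g v * \<Phi> vs - expand g (\<lambda>w. \<Phi> (v # w)) vs"

text \<open>The bound on \<open>length w\<close> feeds the termination proof of the Pfaffian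
  recursion; the bound on \<open>set w\<close> lets later congruence arguments stay within the given
  indices.\<close>

lemma expand_cong [fundef_cong]:
  assumes "xs = ys" "\<And>y. y \<in> set ys \<Longrightarrow> g y = h y"
    and "\<And>w. length w < length ys \<Longrightarrow> set w \<subseteq> set ys \<Longrightarrow> \<Phi> w = \<Psi> w"
  shows "expand g \<Phi> xs = expand h \<Psi> ys"
  unfolding assms(1) using assms(2,3)
proof (induction ys arbitrary: \<Phi> \<Psi>)
  case (Cons v vs)
  have "expand g (\<lambda>w. \<Phi> (v # w)) vs = expand h (\<lambda>w. \<Psi> (v # w)) vs"
    using Cons.prems by (intro Cons.IH) (auto intro!: Cons.prems(2) simp: subset_iff)
  moreover have "\<Phi> vs = \<Psi> vs" "g v = h v"
    using Cons.prems by auto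
  ultimately show ?case by simp
qed simp

lemma expand_append:
  "expand g \<Phi> (us @ vs) =
   expand g (\<lambda>w. \<Phi> (w @ vs)) us + (-1) ^ length us * expand g (\<lambda>w. \<Phi> (us @ w)) vs"
  by (induction us arbitrary: \<Phi>) (simp_all add: algebra_simps)

lemma expand_map: "expand g \<Phi> (map h xs) = expand (\<lambda>x. g (h x)) (\<lambda>w. \<Phi> (map h w)) xs"
  by (induction xs arbitrary: \<Phi>) simp_all

definition delete_nth :: "nat \<Rightarrow> 'b list \<Rightarrow> 'b list" where
  "delete_nth k xs = take k xs @ drop (Suc k) xs"

lemma expand_eq_sum:
  "expand g \<Phi> xs = (\<Sum>k<length xs. (-1) ^ k * g (xs ! k) * \<Phi> (delete_nth k xs))"
  by (induction xs arbitrary: \<Phi>)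
    (simp_all add: sum.lessThan_Suc_shift delete_nth_def sum_negf del: sum.lessThan_Suc)

lemma expand_add_left: "expand (\<lambda>x. g x + h x) \<Phi> xs = expand g \<Phi> xs + expand h \<Phi> xs"
  by (simp add: expand_eq_sum sum.distrib algebra_simps)

lemma expand_scale_left: "expand (\<lambda>x. c * g x) \<Phi> xs = c * expand g \<Phi> xs"
  by (simp add: expand_eq_sum sum_distrib_left algebra_simps)

lemma expand_sum_left:
  "expand (\<lambda>x. \<Sum>i\<in>I. g i x) \<Phi> xs = (\<Sum>i\<in>I. expand (g i) \<Phi> xs)"
  unfolding expand_eq_sum by (subst sum.swap) (simp add: sum_distrib_left sum_distrib_right)

lemma expand_uminus_right: "expand g (\<lambda>w. - \<Phi> w) xs = - expand g \<Phi> xs"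
  by (simp add: expand_eq_sum sum_negf)

lemma expand_scale_right: "expand g (\<lambda>w. c * \<Phi> w) xs = c * expand g \<Phi> xs"
  by (simp add: expand_eq_sum sum_distrib_left algebra_simps)

lemma expand_sum_right:
  "expand g (\<lambda>w. \<Sum>i\<in>I. \<Phi> i w) xs = (\<Sum>i\<in>I. expand g (\<Phi> i) xs)"
  unfolding expand_eq_sum by (subst sum.swap) (simp add: sum_distrib_left)

lemma expand_zero_left: "(\<And>x. x \<in> set xs \<Longrightarrow> g x = 0) \<Longrightarrow> expand g \<Phi> xs = 0"
  by (simp add: expand_eq_sum)

lemma expand_diff_right: "expand g (\<lambda>w. \<Phi> w - \<Psi> w) xs = expand g \<Phi> xs - expand g \<Psi> xs"
  by (simp add: expand_eq_sum sum_subtractf algebra_simps)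

text \<open>Deleting two entries in the two possible orders gives opposite signs. In the induction
  the two terms that delete \<open>v\<close> trade places with opposite signs, and the rest is the
  induction hypothesis.\<close>

lemma expand_expand_swap: "expand g (expand h \<Phi>) vs = - expand h (expand g \<Phi>) vs"
proof (induction vs arbitrary: \<Phi>)
  case (Cons v vs)
  show ?case
    using Cons[of "\<lambda>w. \<Phi> (v # w)"]
    by (simp add: expand_diff_right expand_scale_right)
qed simp

text \<open>Anticommutation with \<open>h = g\<close> would only make twice the value vanish. Here
  the two terms that delete \<open>v\<close> cancel outright.\<close>

lemma expand_expand_self: "expand g (expand g \<Phi>) vs = 0"
proof (induction vs arbitrary: \<Phi>)
  case (Cons v vs)
  show ?case
    using Cons[of "\<lambda>w. \<Phi> (v # w)"]
    by (simp add: expand_diff_right expand_scale_right)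
qed simp

section \<open>Pfaffians of lists of indices and their alternation\<close>

function pf :: "('b \<Rightarrow> 'b \<Rightarrow> 'a) \<Rightarrow> 'b list \<Rightarrow> 'a :: comm_ring_1" where
  "pf f [] = 1"
| "pf f (x # xs) = expand (f x) (pf f) xs"
  by pat_completeness auto
termination by (relation "measure (\<lambda>(f, xs). length xs)") auto

lemma pf_cong:
  assumes "\<And>x y. x \<in> set xs \<Longrightarrow> y \<in> set xs \<Longrightarrow> f x y = g x y"
  shows "pf f xs = pf g xs"
  using assms
proof (induction f xs rule: pf.induct)
  case (2 f x xs)
  have "expand (f x) (pf f) xs = expand (g x) (pf g) xs"
    by (rule expand_cong) (use 2 in \<open>auto intro!: 2(1) simp: subset_iff\<close>)
  then show ?case by simp
qed simp

lemma pf_map: "pf f (map h xs) = pf (\<lambda>x y. f (h x) (h y)) xs"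
proof (induction "length xs" arbitrary: xs rule: less_induct)
  case less
  show ?case
  proof (cases xs)
    case (Cons y ys)
    then show ?thesis
      by (simp add: expand_map) (rule expand_cong, use less Cons in auto)
  qed simp
qed

text \<open>Each recursion step removes two entries, so an odd list ends in an expansion over the
  empty list, which is 0. This later allows sums over even subsets to be extended to all
  subsets.\<close>

lemma pf_odd: "odd (length xs) \<Longrightarrow> pf f xs = 0"
proof (induction "length xs" arbitrary: xs rule: less_induct)
  case less
  then obtain y ys where xs: "xs = y # ys" by (cases xs) auto
  have "pf f (delete_nth k ys) = 0" if "k < length ys" for k
    by (rule less.hyps) (use that less.prems xs in \<open>auto simp: delete_nth_def\<close>)
  then show ?case by (simp add: xs expand_eq_sum)
qed

definition alternating_form :: "('b \<Rightarrow> 'b \<Rightarrow> 'a :: comm_ring_1) \<Rightarrow> bool" where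
  "alternating_form f \<longleftrightarrow> (\<forall>x. f x x = 0) \<and> (\<forall>x y. f x y = - f y x)"

text \<open>Moving one entry to the front is the form of antisymmetry that matches an expansion.
  Vanishing on repetitions is a separate clause because the sign rule alone yields it only up to a
  factor 2.\<close>

definition alternating_on_lists :: "('b list \<Rightarrow> 'a :: comm_ring_1) \<Rightarrow> bool" where
  "alternating_on_lists \<Phi> \<longleftrightarrow>
     (\<forall>us j vs. \<Phi> (us @ j # vs) = (-1) ^ length us * \<Phi> (j # us @ vs)) \<and>
     (\<forall>j vs. j \<in> set vs \<longrightarrow> \<Phi> (j # vs) = 0)"

text \<open>With nothing in front, the claim is the anticommutation of the contractions by
  \<open>f x\<close> and \<open>f y\<close>. Otherwise expand along the first entry: the terms
  deleting \<open>x\<close> or \<open>y\<close> exchange roles, and every other term still contains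
  the adjacent pair in a shorter list.\<close>

lemma pf_swap:
  assumes f: "alternating_form f"
  shows "pf f (us @ x # y # vs) = - pf f (us @ y # x # vs)"
proof (induction "length us + length vs" arbitrary: us vs rule: less_induct)
  case less
  show ?case
  proof (cases us)
    case Nil
    have "expand (f x) (\<lambda>w. pf f (y # w)) vs = - expand (f y) (\<lambda>w. pf f (x # w)) vs"
      using expand_expand_swap[of "f x" "f y" "pf f" vs] by simp
    moreover have "f x y = - f y x"
      using f unfolding alternating_form_def by blast
    ultimately show ?thesis by (simp add: Nil)
  next
    case (Cons u us')
    have 1: "expand (f u) (\<lambda>w. pf f (w @ x # y # vs)) us' = expand (f u) (\<lambda>w. - pf f (w @ y # x # vs)) us'"
      by (rule expand_cong) (use less Cons in auto)
    have 2: "expand (f u) (\<lambda>w. pf f (us' @ x # y # w)) vs = expand (f u) (\<lambda>w. - pf f (us' @ y # x # w)) vs"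
      by (rule expand_cong) (use less Cons in auto)
    show ?thesis
      by (simp add: Cons expand_append 1 2 expand_uminus_right algebra_simps)
  qed
qed

lemma pf_repeat:
  assumes f: "alternating_form f"
  shows "pf f (x # x # vs) = 0"
proof -
  have "f x x = 0"
    using f unfolding alternating_form_def by blast
  then show ?thesis
    using expand_expand_self[of "f x" "pf f" vs] by simp
qed

lemma pf_move:
  assumes f: "alternating_form f"
  shows "pf f (us @ j # vs) = (-1) ^ length us * pf f (j # us @ vs)"
proof (induction us arbitrary: vs rule: rev_induct)
  case (snoc u us)
  have "pf f ((us @ [u]) @ j # vs) = - pf f (us @ j # u # vs)"
    using pf_swap[OF f, of us u j vs] by simp
  also have "\<dots> = (-1) ^ length (us @ [u]) * pf f (j # us @ u # vs)"
    by (simp only: snoc length_append power_add) (simp del: pf.simps)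
  finally show ?case by (simp del: pf.simps)
qed simp

lemma alternating_pf:
  assumes f: "alternating_form f"
  shows "alternating_on_lists (pf f)"
  unfolding alternating_on_lists_def
proof (intro conjI allI impI)
  fix j and vs :: "'a list"
  assume "j \<in> set vs"
  then obtain u v where "vs = u @ j # v" by (meson split_list)
  then have "pf f (j # vs) = (-1) ^ Suc (length u) * pf f (j # j # u @ v)"
    using pf_move[OF f, of "j # u" j v] by (simp del: pf.simps)
  then show "pf f (j # vs) = 0"
    using pf_repeat[OF f] by (simp del: pf.simps)
qed (rule pf_move[OF f])

lemma alternating_prefix:
  assumes "alternating_on_lists \<Phi>" "inj h"
  shows "alternating_on_lists (\<lambda>w. \<Phi> (p @ map h w))"
  unfolding alternating_on_lists_def
proof (intro conjI allI impI)
  have mv: "\<Phi> (us @ j # vs) = (-1) ^ length us * \<Phi> (j # us @ vs)" for us j vs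
    using assms by (simp add: alternating_on_lists_def)
  show "\<Phi> (p @ map h (us @ j # vs)) = (-1) ^ length us * \<Phi> (p @ map h (j # us @ vs))" for us j vs
    \<comment> \<open>Both lists are compared with the one that has \<open>h j\<close> in front of
      \<open>p\<close>; the sign for passing \<open>p\<close> occurs on both sides and
      cancels.\<close>
    using mv[of "p @ map h us" "h j" "map h vs"] mv[of p "h j" "map h us @ map h vs"]
    by (simp add: power_add)
  show "\<Phi> (p @ map h (j # vs)) = 0" if "j \<in> set vs" for j vs
    using mv[of p "h j" "map h vs"] assms(1) that by (simp add: alternating_on_lists_def)
qed

section \<open>Expansions inside sums over subsets\<close>

text \<open>The sign \<open>(-1) ^ k\<close> of the k-th term of the expansion is also the sign of
  moving the k-th entry to the front in \<open>\<Phi>\<close>. The two cancel, leaving a sum over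
  elements that no longer mentions positions.\<close>

lemma alternating_mult_expand:
  assumes \<Phi>: "alternating_on_lists \<Phi>" and d: "distinct ks"
  shows "\<Phi> ks * expand g \<Psi> ks =
         (\<Sum>j\<in>set ks. g j * \<Phi> (j # remove1 j ks) * \<Psi> (remove1 j ks))"
proof -
  have "(\<Sum>j\<in>set ks. g j * \<Phi> (j # remove1 j ks) * \<Psi> (remove1 j ks)) =
        (\<Sum>k<length ks. g (ks ! k) * \<Phi> (ks ! k # remove1 (ks ! k) ks) * \<Psi> (remove1 (ks ! k) ks))"
    by (rule sum.reindex_bij_betw[symmetric]) (use d in \<open>auto intro: bij_betw_nth\<close>)
  also have "\<dots> = (\<Sum>k<length ks. \<Phi> ks * ((-1) ^ k * g (ks ! k) * \<Psi> (delete_nth k ks)))"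
  proof (rule sum.cong[OF refl])
    fix k assume "k \<in> {..<length ks}"
    then have k: "k < length ks" by simp
    have eq: "ks = take k ks @ ks ! k # drop (Suc k) ks"
      using k by (rule id_take_nth_drop)
    \<comment> \<open>\<open>remove1\<close> deletes the first occurrence, which by distinctness is
      position \<open>k\<close>.\<close>
    have "ks ! k \<notin> set (take k ks)"
      using d by (subst (asm) eq) simp
    then have r: "remove1 (ks ! k) ks = delete_nth k ks"
      by (subst (2) eq) (simp add: remove1_append delete_nth_def)
    have "\<Phi> ks = \<Phi> (take k ks @ ks ! k # drop (Suc k) ks)"
      using eq by simp
    also have "\<dots> = (-1) ^ k * \<Phi> (ks ! k # delete_nth k ks)"
      using \<Phi> k by (simp add: alternating_on_lists_def delete_nth_def)
    finally show "g (ks ! k) * \<Phi> (ks ! k # remove1 (ks ! k) ks) * \<Psi> (remove1 (ks ! k) ks) =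
      \<Phi> ks * ((-1) ^ k * g (ks ! k) * \<Psi> (delete_nth k ks))"
      by (simp add: r mult_ac)
  qed
  finally show ?thesis by (simp add: expand_eq_sum sum_distrib_left)
qed

text \<open>Pairs with \<open>j \<in> K\<close> correspond to pairs with \<open>j \<notin> K\<close>
  by removing \<open>j\<close> from the set. The pairs that are then missing on the right contribute
  0 by assumption.\<close>

lemma sum_subsets_remove:
  assumes "finite L" "\<And>j K. j \<in> K \<Longrightarrow> K \<subseteq> L \<Longrightarrow> F j K = 0"
  shows "(\<Sum>K\<in>Pow L. \<Sum>j\<in>K. F j (K - {j})) = (\<Sum>K\<in>Pow L. \<Sum>j\<in>L. (F j K :: 'a :: comm_ring_1))"
proof -
  have fin: "finite K" if "K \<subseteq> L" for K
    using that assms(1) finite_subset by blast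
  have "(\<Sum>K\<in>Pow L. \<Sum>j\<in>K. F j (K - {j})) = (\<Sum>(K, j)\<in>(SIGMA K:Pow L. K). F j (K - {j}))"
    by (rule sum.Sigma) (use assms(1) fin in auto)
  also have "\<dots> = (\<Sum>(K, j)\<in>(SIGMA K:Pow L. L - K). F j K)"
    by (rule sum.reindex_bij_witness[where i = "\<lambda>(K, j). (insert j K, j)" and j = "\<lambda>(K, j). (K - {j}, j)"])
      auto
  also have "\<dots> = (\<Sum>K\<in>Pow L. \<Sum>j\<in>L - K. F j K)"
    by (rule sum.Sigma[symmetric]) (use assms(1) in auto)
  also have "\<dots> = (\<Sum>K\<in>Pow L. \<Sum>j\<in>L. F j K)"
    by (intro sum.cong[OF refl] sum.mono_neutral_left) (use assms in auto)
  finally show ?thesis .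
qed

text \<open>Contraction of one factor is adjoint to prepending an index to the other: the
  \<open>j\<close> deleted from the argument of \<open>\<Psi>\<close> reappears in front of that of
  \<open>\<Phi>\<close>. Alternation of \<open>\<Phi>\<close> removes the terms with
  \<open>j \<in> K\<close>.\<close>

lemma sum_subsets_expand:
  fixes L :: "'b :: linorder set"
  assumes \<Phi>: "alternating_on_lists \<Phi>" and L: "finite L"
  shows "(\<Sum>K\<in>Pow L. \<Phi> (sorted_list_of_set K) * expand g \<Psi> (sorted_list_of_set K)) =
         (\<Sum>K\<in>Pow L. \<Sum>j\<in>L. g j * \<Phi> (j # sorted_list_of_set K) * \<Psi> (sorted_list_of_set K))"
proof -
  have fin: "finite K" if "K \<subseteq> L" for K
    using that L finite_subset by blast
  have "(\<Sum>K\<in>Pow L. \<Phi> (sorted_list_of_set K) * expand g \<Psi> (sorted_list_of_set K)) =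
    (\<Sum>K\<in>Pow L. \<Sum>j\<in>K. g j * \<Phi> (j # sorted_list_of_set (K - {j})) * \<Psi> (sorted_list_of_set (K - {j})))"
    by (intro sum.cong[OF refl])
      (simp add: alternating_mult_expand[OF \<Phi>] fin sorted_list_of_set_remove)
  also have "\<dots> = (\<Sum>K\<in>Pow L. \<Sum>j\<in>L. g j * \<Phi> (j # sorted_list_of_set K) * \<Psi> (sorted_list_of_set K))"
    by (rule sum_subsets_remove[OF L]) (use \<Phi> fin in \<open>auto simp: alternating_on_lists_def\<close>)
  finally show ?thesis .
qed

section \<open>The bordered form and the common recursion\<close>

text \<open>The entries of the block matrix with border \<open>s\<close>, indexed by a disjoint sum.
  The form does not depend on \<open>K\<close>: choosing columns only changes the list of indices at
  which its Pfaffian is taken.\<close>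

fun bordered_form :: "('x \<Rightarrow> 'x \<Rightarrow> 'a) \<Rightarrow> ('x \<Rightarrow> 'y \<Rightarrow> 'a) \<Rightarrow> 'x + 'y \<Rightarrow> 'x + 'y \<Rightarrow> 'a :: comm_ring_1" where
  "bordered_form a s (Inl x) (Inl y) = a x y"
| "bordered_form a s (Inl x) (Inr j) = s x j"
| "bordered_form a s (Inr i) (Inl y) = - s y i"
| "bordered_form a s (Inr i) (Inr j) = 0"

lemma alternating_bordered_form:
  assumes "alternating_form a"
  shows "alternating_form (bordered_form a s)"
  unfolding alternating_form_def
proof (intro conjI allI)
  have a: "a x x = 0" "a x y = - a y x" for x y
    using assms unfolding alternating_form_def by blast+
  show "bordered_form a s p p = 0" for p
    by (cases p) (simp_all add: a(1))
  show "bordered_form a s p q = - bordered_form a s q p" for p q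
    by (cases p; cases q) (auto intro: a(2))
qed

lemma sum_pf_bordered_form:
  fixes L :: "'y :: linorder set" and s :: "'x \<Rightarrow> 'y \<Rightarrow> 'a :: comm_ring_1"
  assumes a: "alternating_form a" and b: "alternating_form b" and L: "finite L"
  shows "(\<Sum>K\<in>Pow L. pf b (sorted_list_of_set K) *
            pf (bordered_form a s) (map Inl xs @ map Inr (sorted_list_of_set K))) =
         pf (\<lambda>x y. a x y - (\<Sum>j\<in>L. \<Sum>i\<in>L. s x j * b j i * s y i)) xs"
    (is "?G xs = pf ?c xs")
proof (induction "length xs" arbitrary: xs rule: less_induct)
  case less
  let ?f = "bordered_form a s"
  let ?sl = sorted_list_of_set
  have fin: "finite K" if "K \<subseteq> L" for K
    using that L finite_subset by blast
  show ?case
  proof (cases xs)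
    case Nil
    \<comment> \<open>The block of border against border is zero, so without row indices only the
      empty \<open>K\<close> contributes.\<close>
    have "pf ?f (map Inr (?sl K)) = 0" if "K \<subseteq> L" "K \<noteq> {}" for K
    proof -
      have "?sl K \<noteq> []"
        using that fin by simp
      then obtain k ks where "?sl K = k # ks"
        by (meson neq_Nil_conv)
      then show ?thesis by (simp add: expand_map expand_zero_left)
    qed
    then have "?G xs = (\<Sum>K\<in>Pow L. if K = {} then 1 else 0)"
      by (intro sum.cong) (auto simp: Nil)
    then show ?thesis using L by (simp add: Nil)
  next
    case (Cons x ys)
    define n where "n = length ys"
    \<comment> \<open>Two views of one Pfaffian: \<open>P\<close> varies the row indices for a fixed
      border \<open>K\<close>, and \<open>\<Psi>\<close> varies the border for the fixed rows
      \<open>ys\<close>. They agree in that \<open>\<Psi> (?sl K) = P K ys\<close>.\<close>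
    define P where "P = (\<lambda>K w. pf ?f (map Inl w @ map Inr (?sl K)))"
    define \<Psi> where "\<Psi> = (\<lambda>w. pf ?f (map Inl ys @ map Inr w))"
    have alt_f: "alternating_on_lists (pf ?f)" and alt_b: "alternating_on_lists (pf b)"
      using a b by (auto intro: alternating_pf alternating_bordered_form)
    have alt_\<Psi>: "alternating_on_lists \<Psi>"
      unfolding \<Psi>_def by (rule alternating_prefix[OF alt_f]) simp
    have G: "?G w = (\<Sum>K\<in>Pow L. pf b (?sl K) * P K w)" for w
      by (simp add: P_def)
    have row: "P K xs = expand (a x) (P K) ys + (-1) ^ n * expand (s x) \<Psi> (?sl K)" for K
      by (simp add: P_def \<Psi>_def n_def Cons expand_append expand_map)
    \<comment> \<open>Moving \<open>Inr i\<close> past \<open>ys\<close> costs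
      \<open>(-1) ^ n\<close>; the expansion along it then meets only the rows, since the border
      block is zero.\<close>
    have \<Psi>_Cons: "\<Psi> (i # ?sl K) = (-1) ^ n * expand (\<lambda>y. - s y i) (P K) ys" for i K
    proof -
      have "\<Psi> (i # ?sl K) = (-1) ^ n * pf ?f (Inr i # map Inl ys @ map Inr (?sl K))"
        unfolding \<Psi>_def
        using alt_f by (simp add: alternating_on_lists_def n_def del: pf.simps)
      also have "pf ?f (Inr i # map Inl ys @ map Inr (?sl K)) = expand (\<lambda>y. - s y i) (P K) ys"
        by (simp add: expand_append expand_map expand_zero_left P_def)
      finally show ?thesis .
    qed
    have "(\<Sum>K\<in>Pow L. pf b (?sl K) * expand (s x) \<Psi> (?sl K)) =
        (\<Sum>K\<in>Pow L. \<Sum>j\<in>L. s x j * pf b (j # ?sl K) * \<Psi> (?sl K))"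
      by (rule sum_subsets_expand[OF alt_b L])
    \<comment> \<open>Unfolding \<open>pf b\<close> at its new first index \<open>j\<close> makes it
      the contracted factor, so the same adjointness applies again with the roles of
      \<open>pf b\<close> and \<open>\<Psi>\<close> exchanged.\<close>
    also have "\<dots> = (\<Sum>j\<in>L. s x j * (\<Sum>K\<in>Pow L. \<Psi> (?sl K) * expand (b j) (pf b) (?sl K)))"
      by (subst sum.swap) (simp add: sum_distrib_left mult_ac)
    also have "\<dots> = (\<Sum>j\<in>L. s x j * (\<Sum>K\<in>Pow L. \<Sum>i\<in>L. b j i * \<Psi> (i # ?sl K) * pf b (?sl K)))"
      by (simp add: sum_subsets_expand[OF alt_\<Psi> L])
    also have "\<dots> = (-1) ^ n * (\<Sum>j\<in>L. \<Sum>K\<in>Pow L. \<Sum>i\<in>L.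
        pf b (?sl K) * (s x j * b j i * expand (\<lambda>y. - s y i) (P K) ys))"
      by (simp add: \<Psi>_Cons sum_distrib_left mult_ac)
    also have "(\<Sum>j\<in>L. \<Sum>K\<in>Pow L. \<Sum>i\<in>L.
          pf b (?sl K) * (s x j * b j i * expand (\<lambda>y. - s y i) (P K) ys)) =
        (\<Sum>K\<in>Pow L. pf b (?sl K) *
          (\<Sum>j\<in>L. \<Sum>i\<in>L. s x j * b j i * expand (\<lambda>y. - s y i) (P K) ys))"
      by (subst sum.swap) (simp add: sum_distrib_left)
    also have "\<dots> = (\<Sum>K\<in>Pow L. pf b (?sl K) *
          expand (\<lambda>y. \<Sum>j\<in>L. \<Sum>i\<in>L. s x j * b j i * - s y i) (P K) ys)"
      by (simp only: expand_sum_left expand_scale_left)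
    finally have snd: "(\<Sum>K\<in>Pow L. pf b (?sl K) * expand (s x) \<Psi> (?sl K)) =
        (-1) ^ n * (\<Sum>K\<in>Pow L. pf b (?sl K) *
          expand (\<lambda>y. \<Sum>j\<in>L. \<Sum>i\<in>L. s x j * b j i * - s y i) (P K) ys)" .
    have "?G xs = (\<Sum>K\<in>Pow L. pf b (?sl K) * expand (a x) (P K) ys) +
        (-1) ^ n * (\<Sum>K\<in>Pow L. pf b (?sl K) * expand (s x) \<Psi> (?sl K))"
      by (simp add: G row sum.distrib sum_distrib_left algebra_simps)
    \<comment> \<open>The sign from passing \<open>ys\<close> in the expansion along
      \<open>x\<close> cancels the sign from bringing \<open>i\<close> in front of
      \<open>ys\<close>.\<close>
    also have "\<dots> = (\<Sum>K\<in>Pow L. pf b (?sl K) * expand (a x) (P K) ys) +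
        (\<Sum>K\<in>Pow L. pf b (?sl K) *
          expand (\<lambda>y. \<Sum>j\<in>L. \<Sum>i\<in>L. s x j * b j i * - s y i) (P K) ys)"
      unfolding snd by simp
    also have "\<dots> = (\<Sum>K\<in>Pow L. pf b (?sl K) *
          expand (\<lambda>y. a x y + (\<Sum>j\<in>L. \<Sum>i\<in>L. s x j * b j i * - s y i)) (P K) ys)"
      by (simp only: expand_add_left distrib_left sum.distrib)
    also have "\<dots> = expand (?c x) ?G ys"
      by (simp add: G expand_sum_right expand_scale_right sum_negf)
    also have "\<dots> = expand (?c x) (pf ?c) ys"
      by (rule expand_cong) (use less Cons in auto)
    finally show ?thesis by (simp add: Cons)
  qed
qed

section \<open>Recursive structure of the permutations in the Pfaffian\<close>

lemma nth_delete_nth: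
  assumes "Suc i < length xs"
  shows "delete_nth k xs ! i = xs ! insert_index k i"
  using assms by (auto simp: delete_nth_def insert_index_def nth_append min_def)

lemma insert_index_less_iff: "insert_index k i < insert_index k j \<longleftrightarrow> i < j"
  by (auto simp: insert_index_def)

text \<open>Prepends the pair \<open>(0, k + 1)\<close> to the perfect matching encoded by \<open>\<sigma>\<close>.\<close>

abbreviation pfaffian_perm_insert :: "nat \<Rightarrow> (nat \<Rightarrow> nat) \<Rightarrow> nat \<Rightarrow> nat" where
  "pfaffian_perm_insert k \<sigma> \<equiv> permutation_insert 0 0 (permutation_insert 0 k \<sigma>)"

text \<open>The inner insertion sends position 0 to \<open>k\<close>; the outer one adds the fixed
  point 0 and raises all other positions and values by one, hence \<open>Suc k\<close>.\<close>

lemma pfaffian_perm_insert_simps: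
  "pfaffian_perm_insert k \<sigma> 0 = 0"
  "pfaffian_perm_insert k \<sigma> (Suc 0) = Suc k"
  "pfaffian_perm_insert k \<sigma> (Suc (Suc i)) = Suc (insert_index k (\<sigma> i))"
  by (simp_all add: permutation_insert_expand insert_index_def)

text \<open>\<open>Suc\<close> and \<open>insert_index k\<close> are strictly increasing, so the
  order conditions on the old pairs are unchanged; the new first pair starts with the least value
  0.\<close>

lemma pfaffian_perm_insert_mem_iff:
  assumes \<sigma>: "\<sigma> permutes {0..<2 * r}" and k: "k < Suc (2 * r)"
  shows "pfaffian_perm_insert k \<sigma> \<in> pfaffian_perms (Suc r) \<longleftrightarrow> \<sigma> \<in> pfaffian_perms r"
proof -
  have 1: "pfaffian_perm_insert k \<sigma> permutes {0..<2 * Suc r}"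
    using permutation_insert_permutes[OF permutation_insert_permutes[OF \<sigma> _ k], of 0 0 0] by simp
  have 2: "(\<forall>i j. i < j \<longrightarrow> j < Suc r \<longrightarrow> pfaffian_perm_insert k \<sigma> (2 * i) < pfaffian_perm_insert k \<sigma> (2 * j)) \<longleftrightarrow>
      (\<forall>i j. i < j \<longrightarrow> j < r \<longrightarrow> \<sigma> (2 * i) < \<sigma> (2 * j))" (is "?L \<longleftrightarrow> ?R")
  proof (intro iffI allI impI)
    fix i j assume ?L "i < j" "j < r"
    then have "pfaffian_perm_insert k \<sigma> (2 * Suc i) < pfaffian_perm_insert k \<sigma> (2 * Suc j)"
      using Suc_less_eq by blast
    then show "\<sigma> (2 * i) < \<sigma> (2 * j)"
      by (simp add: pfaffian_perm_insert_simps insert_index_less_iff)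
  next
    fix i j assume "?R" "i < j" "j < Suc r"
    then show "pfaffian_perm_insert k \<sigma> (2 * i) < pfaffian_perm_insert k \<sigma> (2 * j)"
      by (cases i; cases j) (simp_all add: pfaffian_perm_insert_simps insert_index_less_iff)
  qed
  have 3: "(\<forall>i<Suc r. pfaffian_perm_insert k \<sigma> (2 * i) < pfaffian_perm_insert k \<sigma> (2 * i + 1)) \<longleftrightarrow>
      (\<forall>i<r. \<sigma> (2 * i) < \<sigma> (2 * i + 1))"
    by (simp add: All_less_Suc2 pfaffian_perm_insert_simps insert_index_less_iff)
  show ?thesis
    using 1 \<sigma> unfolding pfaffian_perms_def mem_Collect_eq 2 3 by simp
qed

lemma bij_betw_pfaffian_perm_insert:
  "bij_betw (\<lambda>(k, \<sigma>). pfaffian_perm_insert k \<sigma>)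
     ({..<Suc (2 * r)} \<times> pfaffian_perms r) (pfaffian_perms (Suc r))"
proof (rule bij_betw_imageI)
  have perm: "\<sigma> permutes {0..<2 * r}" if "\<sigma> \<in> pfaffian_perms r" for \<sigma>
    using that by (simp add: pfaffian_perms_def)
  show "inj_on (\<lambda>(k, \<sigma>). pfaffian_perm_insert k \<sigma>) ({..<Suc (2 * r)} \<times> pfaffian_perms r)"
  proof (rule inj_onI, clarify)
    fix k \<sigma> k' \<sigma>'
    assume k: "k < Suc (2 * r)" "k' < Suc (2 * r)"
      and \<sigma>: "\<sigma> \<in> pfaffian_perms r" "\<sigma>' \<in> pfaffian_perms r"
      and eq: "pfaffian_perm_insert k \<sigma> = pfaffian_perm_insert k' \<sigma>'"
    have kk: "k = k'"
      using fun_cong[OF eq, of "Suc 0"] by (simp add: pfaffian_perm_insert_simps)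
    have "permutation_insert 0 k \<sigma> = permutation_insert 0 k \<sigma>'"
      by (rule inj_onD[OF permutation_insert_inj_on[of 0 "Suc (2 * r)" 0]])
        (use eq kk k perm \<sigma> in \<open>auto intro!: permutation_insert_permutes\<close>)
    moreover have "inj_on (permutation_insert 0 k) {\<sigma>. \<sigma> permutes {0..<2 * r}}"
      using k(1) by (intro permutation_insert_inj_on) auto
    ultimately have "\<sigma> = \<sigma>'"
      using perm \<sigma> by (auto dest: inj_onD)
    with kk show "k = k' \<and> \<sigma> = \<sigma>'" by simp
  qed
  show "(\<lambda>(k, \<sigma>). pfaffian_perm_insert k \<sigma>) ` ({..<Suc (2 * r)} \<times> pfaffian_perms r) =
    pfaffian_perms (Suc r)"
  proof (intro equalityI subsetI)
    fix \<tau> assume "\<tau> \<in> (\<lambda>(k, \<sigma>). pfaffian_perm_insert k \<sigma>) ` ({..<Suc (2 * r)} \<times> pfaffian_perms r)"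
    then show "\<tau> \<in> pfaffian_perms (Suc r)"
      using perm pfaffian_perm_insert_mem_iff by auto
  next
    fix \<tau> assume \<tau>: "\<tau> \<in> pfaffian_perms (Suc r)"
    then have \<tau>_perm: "\<tau> permutes {0..<Suc (Suc (2 * r))}"
      by (simp add: pfaffian_perms_def)
    have \<tau>_even: "\<tau> (2 * 0) < \<tau> (2 * j)" if "0 < j" "j < Suc r" for j
      using \<tau> that unfolding pfaffian_perms_def mem_Collect_eq by blast
    have \<tau>_odd: "\<tau> (2 * i) < \<tau> (2 * i + 1)" if "i < Suc r" for i
      using \<tau> that unfolding pfaffian_perms_def mem_Collect_eq by blast
    have "0 \<in> \<tau> ` {0..<Suc (Suc (2 * r))}"
      unfolding permutes_image[OF \<tau>_perm] by simp
    then obtain p where p: "p < Suc (Suc (2 * r))" "\<tau> p = 0"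
      by (metis atLeastLessThan_iff imageE)
    \<comment> \<open>A positive even position of the value 0 would violate the order of the first
      entries of pairs, and an odd one the order within its pair.\<close>
    have "p = 0"
    proof (cases "even p")
      case True
      then obtain j where "p = 2 * j" by blast
      then show ?thesis using \<tau>_even[of j] p by (cases "j = 0") auto
    next
      case False
      then obtain i where "p = 2 * i + 1" by (elim oddE)
      then show ?thesis using \<tau>_odd[of i] p by auto
    qed
    with p have "\<tau> 0 = 0" by simp
    then obtain \<rho> where \<rho>: "\<rho> permutes {0..<Suc (2 * r)}" "\<tau> = permutation_insert 0 0 \<rho>"
      using \<tau>_perm permutation_fix[of 0 "Suc (2 * r)" 0] by auto
    have k: "\<rho> 0 < Suc (2 * r)"
      using permutes_in_image[OF \<rho>(1), of 0] by simp
    then obtain \<sigma> where \<sigma>: "\<sigma> permutes {0..<2 * r}" "\<rho> = permutation_insert 0 (\<rho> 0) \<sigma>"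
      using \<rho>(1) permutation_fix[of 0 "2 * r" "\<rho> 0"] by auto
    have \<tau>_eq: "\<tau> = pfaffian_perm_insert (\<rho> 0) \<sigma>"
      using \<rho>(2) \<sigma>(2) by simp
    moreover have "\<sigma> \<in> pfaffian_perms r"
      using \<tau> pfaffian_perm_insert_mem_iff[OF \<sigma>(1) k] unfolding \<tau>_eq by simp
    ultimately show "\<tau> \<in> (\<lambda>(k, \<sigma>). pfaffian_perm_insert k \<sigma>) ` ({..<Suc (2 * r)} \<times> pfaffian_perms r)"
      using k by (intro image_eqI[of _ _ "(\<rho> 0, \<sigma>)"]) auto
  qed
qed

text \<open>Choosing the partner of the first index, at position \<open>k\<close> of the tail, is
  one term of the expansion; the remaining pairs form a matching of the list with both indices
  deleted.\<close>

lemma pf_eq_sum_pfaffian_perms: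
  fixes f :: "'b \<Rightarrow> 'b \<Rightarrow> 'a :: comm_ring_1"
  assumes "length xs = 2 * r"
  shows "pf f xs = (\<Sum>\<sigma>\<in>pfaffian_perms r. of_int (sign \<sigma>) *
           (\<Prod>i<r. f (xs ! \<sigma> (2 * i)) (xs ! \<sigma> (2 * i + 1))))"
  using assms
proof (induction r arbitrary: xs)
  case 0
  have "pfaffian_perms 0 = {id}"
    by (auto simp: pfaffian_perms_def)
  with 0 show ?case by simp
next
  case (Suc r)
  then obtain x ys where xs: "xs = x # ys" and len: "length ys = Suc (2 * r)"
    by (cases xs) auto
  let ?t = "\<lambda>r xs \<sigma>. of_int (sign \<sigma>) * (\<Prod>i<r. f (xs ! \<sigma> (2 * i)) (xs ! \<sigma> (2 * i + 1)))"
  have term_eq: "?t (Suc r) xs (pfaffian_perm_insert k \<sigma>) =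
      (-1) ^ k * f x (ys ! k) * ?t r (delete_nth k ys) \<sigma>"
    if k: "k < Suc (2 * r)" and \<sigma>: "\<sigma> \<in> pfaffian_perms r" for k \<sigma>
  proof -
    have perm: "\<sigma> permutes {0..<2 * r}"
      using \<sigma> by (simp add: pfaffian_perms_def)
    \<comment> \<open>The outer insertion is even; the inner one, from position 0 to value
      \<open>k\<close>, contributes \<open>(-1) ^ k\<close>, the sign of the expansion.\<close>
    have sgn: "of_int (sign (pfaffian_perm_insert k \<sigma>)) = (-1) ^ k * (of_int (sign \<sigma>) :: 'a)"
      using signof_permutation_insert[where 'a = 'a, OF permutation_insert_permutes[OF perm _ k], of 0 0 0]
        signof_permutation_insert[where 'a = 'a, OF perm _ k, of 0] by simp
    have del: "xs ! Suc (insert_index k (\<sigma> j)) = delete_nth k ys ! \<sigma> j" if "j < 2 * r" for j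
      using permutes_in_image[OF perm, of j] that len by (simp add: xs nth_delete_nth)
    have "(\<Prod>i<Suc r. f (xs ! pfaffian_perm_insert k \<sigma> (2 * i)) (xs ! pfaffian_perm_insert k \<sigma> (2 * i + 1))) =
      f x (ys ! k) * (\<Prod>i<r. f (xs ! Suc (insert_index k (\<sigma> (2 * i)))) (xs ! Suc (insert_index k (\<sigma> (2 * i + 1)))))"
      by (simp add: prod.lessThan_Suc_shift pfaffian_perm_insert_simps xs del: prod.lessThan_Suc)
    also have "\<dots> = f x (ys ! k) *
        (\<Prod>i<r. f (delete_nth k ys ! \<sigma> (2 * i)) (delete_nth k ys ! \<sigma> (2 * i + 1)))"
      by (intro arg_cong2[where f = "(*)"] prod.cong refl) (simp add: del)
    finally show ?thesis by (simp only: sgn mult_ac)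
  qed
  have "pf f xs = (\<Sum>k<Suc (2 * r). (-1) ^ k * f x (ys ! k) * pf f (delete_nth k ys))"
    by (simp only: xs pf.simps expand_eq_sum len)
  also have "\<dots> = (\<Sum>k<Suc (2 * r). \<Sum>\<sigma>\<in>pfaffian_perms r.
      (-1) ^ k * f x (ys ! k) * ?t r (delete_nth k ys) \<sigma>)"
    by (rule sum.cong[OF refl], subst Suc.IH)
      (use len in \<open>auto simp: delete_nth_def sum_distrib_left\<close>)
  also have "\<dots> = (\<Sum>(k, \<sigma>)\<in>{..<Suc (2 * r)} \<times> pfaffian_perms r.
      ?t (Suc r) xs (pfaffian_perm_insert k \<sigma>))"
    unfolding sum.cartesian_product by (rule sum.cong) (use term_eq in auto)
  also have "\<dots> = (\<Sum>\<sigma>\<in>pfaffian_perms (Suc r). ?t (Suc r) xs \<sigma>)"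
    by (subst sum.reindex_bij_betw[OF bij_betw_pfaffian_perm_insert, symmetric])
      (simp add: case_prod_unfold)
  finally show ?case .
qed

section \<open>Passing between matrices, submatrices and lists of indices\<close>

lemma pfaffian_eq_pf:
  assumes "even (dim_row X)"
  shows "pfaffian X = pf (\<lambda>i j. X $$ (i, j)) [0..<dim_row X]"
proof -
  obtain r where r: "dim_row X = 2 * r"
    using assms by blast
  have lt: "\<sigma> j < 2 * r" if "\<sigma> \<in> pfaffian_perms r" "j < 2 * r" for \<sigma> j
    using that permutes_in_image[of \<sigma> "{0..<2 * r}" j] by (simp add: pfaffian_perms_def)
  show ?thesis
    unfolding pfaffian_def
    by (subst pf_eq_sum_pfaffian_perms[of _ r]) (auto simp: r lt Let_def intro!: sum.cong prod.cong)
qed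

text \<open>\<open>pick\<close> enumerates \<open>K\<close> in increasing order. This turns
  Pfaffians of submatrices into Pfaffians of the full form at a list of indices.\<close>

lemma map_pick_eq_sorted_list_of_set:
  assumes K: "finite K"
  shows "map (pick K) [0..<card K] = sorted_list_of_set K"
proof -
  have sorted: "sorted_wrt (<) (map (pick K) [0..<card K])"
    by (auto simp: sorted_wrt_iff_nth_less intro: pick_mono_le)
  have "set (map (pick K) [0..<card K]) = K"
  proof (rule card_subset_eq[OF K])
    show "set (map (pick K) [0..<card K]) \<subseteq> K"
      by (auto intro: pick_in_set_le)
    show "card (set (map (pick K) [0..<card K])) = card K"
      using sorted by (subst distinct_card) (auto simp: strict_sorted_iff)
  qed
  with sorted show ?thesis
    using sorted_list_of_set_unique[OF K, of "map (pick K) [0..<card K]"] by simp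
qed

lemma pick_atLeastLessThan:
  assumes "i < n"
  shows "pick {0..<n} i = i"
proof -
  have "map (pick {0..<n}) [0..<n] ! i = [0..<n] ! i"
    using map_pick_eq_sorted_list_of_set[of "{0..<n}"] by simp
  then show ?thesis using assms by simp
qed

lemma pfaffian_submatrix:
  assumes "B \<in> carrier_mat l l" "K \<subseteq> {0..<l}" "even (card K)"
  shows "pfaffian (submatrix B K K) = pf (\<lambda>i j. B $$ (i, j)) (sorted_list_of_set K)"
proof -
  have K: "{i. i < l \<and> i \<in> K} = K" "finite K"
    using assms(2) finite_subset by auto
  have "pfaffian (submatrix B K K) = pf (\<lambda>i j. submatrix B K K $$ (i, j)) [0..<card K]"
    using assms K by (subst pfaffian_eq_pf) (simp_all add: dim_submatrix)
  also have "\<dots> = pf (\<lambda>i j. B $$ (pick K i, pick K j)) [0..<card K]"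
    by (rule pf_cong) (use assms K in \<open>simp add: submatrix_def\<close>)
  finally show ?thesis
    using K by (simp add: pf_map map_pick_eq_sorted_list_of_set[symmetric])
qed

lemma pfaffian_bordered_submatrix:
  assumes A: "A \<in> carrier_mat m m" and S: "S \<in> carrier_mat m l"
    and K: "K \<subseteq> {0..<l}" "even (card K)" and m: "even m"
  shows "pfaffian (four_block_mat A (submatrix S {0..<m} K)
           (- transpose_mat (submatrix S {0..<m} K)) (0\<^sub>m (card K) (card K))) =
         pf (bordered_form (\<lambda>i j. A $$ (i, j)) (\<lambda>i j. S $$ (i, j)))
           (map Inl [0..<m] @ map Inr (sorted_list_of_set K))"
    (is "pfaffian ?X = pf ?f ?xs")
proof -
  have K': "{i. i < l \<and> i \<in> K} = K" "finite K"
    using K(1) finite_subset by auto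
  let ?c = "card K"
  \<comment> \<open>Relabels the indices of the block matrix: those below \<open>m\<close> are rows
    of \<open>A\<close>, the others are border columns, named by the element of \<open>K\<close>
    that they stand for.\<close>
  let ?h = "\<lambda>i. if i < m then Inl i else Inr (pick K (i - m))"
  have "{i. i < m \<and> i \<in> {0..<m}} = {0..<m}" by auto
  then have sub: "submatrix S {0..<m} K = mat m ?c (\<lambda>(i, j). S $$ (i, pick K j))"
    using S K' by (auto simp: submatrix_def pick_atLeastLessThan)
  have upt: "[0..<m + ?c] = [0..<m] @ map (\<lambda>j. j + m) [0..<?c]"
    by (simp add: map_add_upt upt_add_eq_append[of 0] add.commute)
  have "pfaffian ?X = pf (\<lambda>i j. ?X $$ (i, j)) [0..<m + ?c]"
    using K m carrier_matD(1)[OF A] by (subst pfaffian_eq_pf) simp_all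
  also have "\<dots> = pf (\<lambda>i j. ?f (?h i) (?h j)) [0..<m + ?c]"
    by (rule pf_cong) (use A in \<open>auto simp: sub\<close>)
  also have "\<dots> = pf ?f (map ?h [0..<m + ?c])"
    by (rule pf_map[symmetric])
  also have "map ?h [0..<m + ?c] = ?xs"
    unfolding upt by (simp add: map_pick_eq_sorted_list_of_set[OF K'(2), symmetric])
  finally show ?thesis .
qed

text \<open>Alternation is demanded on the whole index type, whereas entries outside a matrix are
  unspecified; hence the extension by zero.\<close>

lemma alternating_form_skew_symmetric_mat:
  assumes A: "A \<in> carrier_mat n n" and skew: "skew_symmetric_mat A"
  shows "alternating_form (\<lambda>i j. if i < n \<and> j < n then A $$ (i, j) else 0)"
proof -
  have anti: "A $$ (i, j) = - A $$ (j, i)" if "i < n" "j < n" for i j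
  proof -
    have "transpose_mat A $$ (j, i) = (- A) $$ (j, i)"
      using skew by (simp add: skew_symmetric_mat_def)
    then show ?thesis using A that by simp
  qed
  have diag: "A $$ (i, i) = 0" if "i < n" for i
    using skew A that by (simp add: skew_symmetric_mat_def)
  show ?thesis
    unfolding alternating_form_def
  proof (intro conjI allI)
    fix i j
    show "(if i < n \<and> j < n then A $$ (i, j) else 0) = - (if j < n \<and> i < n then A $$ (j, i) else 0)"
      using anti[of i j] by auto
  qed (simp add: diag)
qed

theorem theorem3p4:
  fixes m l :: nat
    and A B S :: "'a :: comm_ring_1 mat"
  assumes "even m" and "l > 0"
    and "A \<in> carrier_mat m m" and "skew_symmetric_mat A"
    and "B \<in> carrier_mat l l" and "skew_symmetric_mat B"
    and "S \<in> carrier_mat m l"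
  shows "(\<Sum>K\<in>{K. K \<subseteq> {0..<l} \<and> even (card K)}.
            pfaffian (submatrix B K K) *
            pfaffian (four_block_mat A (submatrix S {0..<m} K)
                        (- transpose_mat (submatrix S {0..<m} K)) (0\<^sub>m (card K) (card K)))) =
         pfaffian (A - S * B * transpose_mat S)"
proof -
  let ?L = "{0..<l}"
  let ?sl = "sorted_list_of_set :: nat set \<Rightarrow> nat list"
  define a where "a i j = (if i < m \<and> j < m then A $$ (i, j) else 0)" for i j
  define b where "b i j = (if i < l \<and> j < l then B $$ (i, j) else 0)" for i j
  let ?s = "\<lambda>i j. S $$ (i, j)"
  let ?C = "A - S * B * transpose_mat S"
  have alt: "alternating_form a" "alternating_form b"
    unfolding a_def b_def
    by (rule alternating_form_skew_symmetric_mat[OF assms(3,4)]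
        alternating_form_skew_symmetric_mat[OF assms(5,6)])+
  have finK: "finite K" if "K \<subseteq> ?L" for K
    using that finite_subset by blast
  have B_eq: "pfaffian (submatrix B K K) = pf b (?sl K)" if "K \<subseteq> ?L" "even (card K)" for K
    unfolding pfaffian_submatrix[OF assms(5) that]
    by (rule pf_cong) (use that finK in \<open>auto simp: b_def subset_iff\<close>)
  have A_eq: "pfaffian (four_block_mat A (submatrix S {0..<m} K)
        (- transpose_mat (submatrix S {0..<m} K)) (0\<^sub>m (card K) (card K))) =
      pf (bordered_form a ?s) (map Inl [0..<m] @ map Inr (?sl K))"
    if "K \<subseteq> ?L" "even (card K)" for K
    unfolding pfaffian_bordered_submatrix[OF assms(3,7) that assms(1)]
    by (rule pf_cong) (auto simp: a_def)
  have C_index: "?C $$ (i, j) = a i j - (\<Sum>p\<in>?L. \<Sum>q\<in>?L. ?s i p * b p q * ?s j q)"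
    if "i < m" "j < m" for i j
  proof -
    have "(S * B * transpose_mat S) $$ (i, j) = (\<Sum>p\<in>?L. ?s i p * (\<Sum>q\<in>?L. B $$ (p, q) * ?s j q))"
      using assms(5,7) that by (simp add: scalar_prod_def)
    also have "\<dots> = (\<Sum>p\<in>?L. \<Sum>q\<in>?L. ?s i p * b p q * ?s j q)"
      by (simp add: sum_distrib_left mult_ac b_def)
    finally show ?thesis
      using assms(3,5,7) that by (simp add: a_def)
  qed
  have "(\<Sum>K\<in>{K. K \<subseteq> ?L \<and> even (card K)}.
        pfaffian (submatrix B K K) *
        pfaffian (four_block_mat A (submatrix S {0..<m} K)
          (- transpose_mat (submatrix S {0..<m} K)) (0\<^sub>m (card K) (card K)))) =
      (\<Sum>K\<in>{K. K \<subseteq> ?L \<and> even (card K)}. pf b (?sl K) *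
        pf (bordered_form a ?s) (map Inl [0..<m] @ map Inr (?sl K)))"
    by (rule sum.cong) (use B_eq A_eq in auto)
  \<comment> \<open>The subsets of odd size may be added, since \<open>pf b\<close> vanishes on
    lists of odd length.\<close>
  also have "\<dots> = (\<Sum>K\<in>Pow ?L. pf b (?sl K) *
        pf (bordered_form a ?s) (map Inl [0..<m] @ map Inr (?sl K)))"
    by (rule sum.mono_neutral_left) (auto simp: pf_odd finK)
  also have "\<dots> = pf (\<lambda>i j. a i j - (\<Sum>p\<in>?L. \<Sum>q\<in>?L. ?s i p * b p q * ?s j q)) [0..<m]"
    by (rule sum_pf_bordered_form[OF alt]) simp
  also have "\<dots> = pf (\<lambda>i j. ?C $$ (i, j)) [0..<m]"
    by (rule pf_cong) (simp add: C_index)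
  also have "\<dots> = pfaffian ?C"
    using assms(1,7) by (subst pfaffian_eq_pf) simp_all
  finally show ?thesis .
qed

end
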